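(* Let $G=(V,E)$ be a finite connected undirected graph with $V=\{1,\dots,N\}$, random walk transition matrix $\mathbb{P}=(p_{ij})$ with $p_{ij}>0$ iff $\{i,j\}\in E$ (irreducible, aperiodic), and $F(A)=\sum_{i\notin A}\mathbf{E}_i[T_A]$ with $T_A=\min\{n>0:X_n\in A\}$. Fix an integer $0<K\le N$, assume $F_{\max}\neq F_{\min}$, fix $0<c\le 1$, and let $L_{c,K}$, $m$, $G_n$ be as in the context, with $m\le K$. Suppose $\widehat g_n$ ($1\le n\le m$) and $\widehat G_n$ ($m\le n\le K$) are families of $n$-element subsets of $V$, each member of $\widehat g_n$ being a subset of some member of $G_m$ and each member of $\widehat G_n$ being a superset of some member of $G_m$, satisfying conditions T1–T4 of the context. Then $\mathcal{F}_{c,K}=\{\emptyset\}\cup\bigcup_{n=1}^{m-1}\widehat g_n\cup\bigcup_{n=m}^{K}\widehat G_n$ is the family of feasible sets of a greedoid over the ground set $V$.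
   Context: $F_{\max}$ and $F_{\min}$ are the maximum and minimum of $F(A)$ over non-empty $A\subseteq V$ with $|A|\le K$; $\rho(A)=\frac{F_{\max}-F(A)}{F_{\max}-F_{\min}}$; $L_{c,K}=\{A\subseteq V: A\ne\emptyset,\ |A|\le K,\ \rho(A)\ge c\}$. $m$ is the minimum cardinality of a set in $L_{c,K}$, and $G_n=\{A\in L_{c,K}:|A|=n\}$ for $m\le n\le K$. With the convention $\widehat g_0=\{\emptyset\}$, the conditions are: T1: $\widehat g_m=\widehat G_m\subseteq G_m$. T2: for $1\le n\le m$, every $A\in\widehat g_n$ contains some $B\in\widehat g_{n-1}$. T3: for $1\le n\le m$, for every $B\in\widehat g_{n-1}$ and $A\in\widehat g_n$ there is $p\in A\setminus B$ with $B\cup\{p\}\in\widehat g_n$. T4: for $m<n\le K$, $\widehat G_n=\{A\in G_n: A\supset B \text{ for some } B\in\widehat G_{n-1}\}$. A pair $(\mathbf{E},\mathcal{F})$ with $\mathcal{F}$ a collection of subsets of $\mathbf{E}$ is a greedoid (with feasible sets $\mathcal{F}$) if: G1 $\emptyset\in\mathcal{F}$; G2 for every non-empty $A\in\mathcal{F}$ there is $a\in A$ with $A\setminus\{a\}\in\mathcal{F}$; G3 for $X,Y\in\mathcal{F}$ with $|X|>|Y|$ there is $x\in X\setminus Y$ with $Y\cup\{x\}\in\mathcal{F}$. *)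

theory Defs
  imports "HOL-Probability.Probability"
begin

text \<open>Undirected graphs: edges are unordered pairs of vertices. Loops \<open>{i, i}\<close> are allowed, since
  they correspond to holding probabilities \<open>p i i > 0\<close> of the walk.\<close>

definition undirected_graph :: "nat set \<Rightarrow> nat set set \<Rightarrow> bool" where
  "undirected_graph V E \<longleftrightarrow> finite V \<and> (\<forall>e\<in>E. \<exists>i\<in>V. \<exists>j\<in>V. e = {i, j})"

definition connected_graph :: "nat set \<Rightarrow> nat set set \<Rightarrow> bool" where
  "connected_graph V E \<longleftrightarrow>
     undirected_graph V E \<and> (\<forall>i\<in>V. \<forall>j\<in>V. (i, j) \<in> {(x, y). {x, y} \<in> E}\<^sup>*)"

definition transition_matrix :: "nat set \<Rightarrow> nat set set \<Rightarrow> (nat \<Rightarrow> nat \<Rightarrow> real) \<Rightarrow> bool" where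
  "transition_matrix V E p \<longleftrightarrow>
     (\<forall>i\<in>V. \<forall>j\<in>V. 0 \<le> p i j) \<and>
     (\<forall>i\<in>V. (\<Sum>j\<in>V. p i j) = 1) \<and>
     (\<forall>i\<in>V. \<forall>j\<in>V. 0 < p i j \<longleftrightarrow> {i, j} \<in> E)"

primrec n_step :: "nat set \<Rightarrow> (nat \<Rightarrow> nat \<Rightarrow> real) \<Rightarrow> nat \<Rightarrow> nat \<Rightarrow> nat \<Rightarrow> real" where
  "n_step V p 0 i j = (if i = j then 1 else 0)"
| "n_step V p (Suc n) i j = (\<Sum>k\<in>V. p i k * n_step V p n k j)"

definition irreducible_matrix :: "nat set \<Rightarrow> (nat \<Rightarrow> nat \<Rightarrow> real) \<Rightarrow> bool" where
  "irreducible_matrix V p \<longleftrightarrow> (\<forall>i\<in>V. \<forall>j\<in>V. \<exists>n. 0 < n_step V p n i j)"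

definition aperiodic_matrix :: "nat set \<Rightarrow> (nat \<Rightarrow> nat \<Rightarrow> real) \<Rightarrow> bool" where
  "aperiodic_matrix V p \<longleftrightarrow> (\<forall>i\<in>V. Gcd {n. 0 < n \<and> 0 < n_step V p n i i} = 1)"

text \<open>Under the probability measure \<open>M\<close>, the process \<open>X\<close> is a time-homogeneous Markov chain on \<open>V\<close>
  with transition probabilities \<open>p\<close>, started at \<open>i\<close>.\<close>

definition markov_chain_from ::
  "nat set \<Rightarrow> (nat \<Rightarrow> nat \<Rightarrow> real) \<Rightarrow> nat \<Rightarrow> 'w measure \<Rightarrow> (nat \<Rightarrow> 'w \<Rightarrow> nat) \<Rightarrow> bool" where
  "markov_chain_from V p i M X \<longleftrightarrow>
     prob_space M \<and>
     (\<forall>n. X n \<in> measurable M (count_space V)) \<and>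
     \<P>(\<omega> in M. X 0 \<omega> = i) = 1 \<and>
     (\<forall>n x. \<forall>j\<in>V. \<P>(\<omega> in M. \<forall>k\<le>n. X k \<omega> = x k) > 0 \<longrightarrow>
        \<P>(\<omega> in M. X (Suc n) \<omega> = j \<bar> \<forall>k\<le>n. X k \<omega> = x k) = p (x n) j)"

text \<open>The value is \<open>\<infinity>\<close> on paths that never visit \<open>A\<close> at a positive time.\<close>

definition hitting_time :: "(nat \<Rightarrow> 'w \<Rightarrow> nat) \<Rightarrow> nat set \<Rightarrow> 'w \<Rightarrow> enat" where
  "hitting_time X A \<omega> = (INF n\<in>{n. 0 < n \<and> X n \<omega> \<in> A}. enat n)"

text \<open>\<open>M i\<close> is the law under which the chain starts at \<open>i\<close>. Expectations are taken in \<open>[0, \<infinity>]\<close>; for an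
  irreducible chain on a finite \<open>V\<close> and non-empty \<open>A \<subseteq> V\<close> they are finite, so the arithmetic on
  extended reals below is that of the reals.\<close>

definition total_hitting_time ::
  "nat set \<Rightarrow> (nat \<Rightarrow> 'w measure) \<Rightarrow> (nat \<Rightarrow> 'w \<Rightarrow> nat) \<Rightarrow> nat set \<Rightarrow> ereal" where
  "total_hitting_time V M X A =
     (\<Sum>i\<in>V - A. enn2ereal (\<integral>\<^sup>+\<omega>. ennreal_of_enat (hitting_time X A \<omega>) \<partial>M i))"

definition admissible :: "nat set \<Rightarrow> nat \<Rightarrow> nat set set" where
  "admissible V K = {A. A \<subseteq> V \<and> A \<noteq> {} \<and> card A \<le> K}"

definition F_max :: "nat set \<Rightarrow> nat \<Rightarrow> (nat set \<Rightarrow> ereal) \<Rightarrow> ereal" where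
  "F_max V K F = Max (F ` admissible V K)"

definition F_min :: "nat set \<Rightarrow> nat \<Rightarrow> (nat set \<Rightarrow> ereal) \<Rightarrow> ereal" where
  "F_min V K F = Min (F ` admissible V K)"

definition rho :: "nat set \<Rightarrow> nat \<Rightarrow> (nat set \<Rightarrow> ereal) \<Rightarrow> nat set \<Rightarrow> ereal" where
  "rho V K F A = (F_max V K F - F A) / (F_max V K F - F_min V K F)"

definition L_sets :: "nat set \<Rightarrow> nat \<Rightarrow> (nat set \<Rightarrow> ereal) \<Rightarrow> real \<Rightarrow> nat set set" where
  "L_sets V K F c = {A. A \<subseteq> V \<and> A \<noteq> {} \<and> card A \<le> K \<and> rho V K F A \<ge> ereal c}"

definition greedoid :: "'a set \<Rightarrow> 'a set set \<Rightarrow> bool" where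
  "greedoid E \<F> \<longleftrightarrow>
     finite E \<and> \<F> \<subseteq> Pow E \<and>
     {} \<in> \<F> \<and>
     (\<forall>A\<in>\<F>. A \<noteq> {} \<longrightarrow> (\<exists>a\<in>A. A - {a} \<in> \<F>)) \<and>
     (\<forall>X\<in>\<F>. \<forall>Y\<in>\<F>. card X > card Y \<longrightarrow> (\<exists>x\<in>X - Y. Y \<union> {x} \<in> \<F>))"

end

theory Submission
  imports Defs
begin

text \<open>Enlarging the target set shortens every hitting time and drops summands, so \<open>F\<close> is antitone and
  \<open>L\<^bsub>c,K\<^esub>\<close> is closed under supersets of size at most \<open>K\<close>. Hence above level \<open>m\<close> every
  one-point extension of a feasible set is feasible, while up to level \<open>m\<close> exchange between consecutive
  levels is condition T3. Exchange between arbitrary levels reduces to consecutive ones, because a feasible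
  set contains feasible sets of all smaller cardinalities.\<close>

lemma hitting_time_antimono:
  assumes "A \<subseteq> B"
  shows "hitting_time X B \<omega> \<le> hitting_time X A \<omega>"
  unfolding hitting_time_def using assms by (intro INF_superset_mono) auto

lemma total_hitting_time_antimono:
  assumes "finite V" "A \<subseteq> B"
  shows "total_hitting_time V M X B \<le> total_hitting_time V M X A"
proof -
  let ?T = "\<lambda>A i. enn2ereal (\<integral>\<^sup>+\<omega>. ennreal_of_enat (hitting_time X A \<omega>) \<partial>M i)"
  have "?T B i \<le> ?T A i" for i
    using hitting_time_antimono[OF assms(2)]
    by (auto simp flip: less_eq_ennreal.rep_eq intro!: nn_integral_mono)
  then have "(\<Sum>i\<in>V - B. ?T B i) \<le> (\<Sum>i\<in>V - B. ?T A i)"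
    by (intro sum_mono)
  \<comment> \<open>The summands gained on passing from V - B to V - A are nonnegative, being images
    of \<open>ennreal\<close> values.\<close>
  also have "\<dots> \<le> (\<Sum>i\<in>V - A. ?T A i)"
    using assms by (intro sum_mono2) auto
  finally show ?thesis
    by (simp add: total_hitting_time_def)
qed

text \<open>With a positive denominator, \<open>rho\<close> can only grow when \<open>F\<close>
  drops, so a superset stays above the threshold c.\<close>

lemma L_sets_superset:
  assumes "finite V" and antimono: "\<And>A B. A \<subseteq> B \<Longrightarrow> F B \<le> F A"
    and nondegenerate: "F_max V K F \<noteq> F_min V K F"
    and A: "A \<in> L_sets V K F c" and B: "A \<subseteq> B" "B \<subseteq> V" "card B \<le> K"
  shows "B \<in> L_sets V K F c"
proof -
  \<comment> \<open>The set A itself links the two extremes: \<open>F_min\<close> \<le> F A \<le>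
    \<open>F_max\<close>.\<close>
  have "A \<in> admissible V K"
    using A by (auto simp: L_sets_def admissible_def)
  moreover have "finite (admissible V K)"
    using \<open>finite V\<close> by (auto simp: admissible_def intro: finite_subset[of _ "Pow V"])
  ultimately have "F_min V K F \<le> F_max V K F"
    unfolding F_min_def F_max_def
    by (meson Max_ge Min_le finite_imageI imageI order_trans)
  \<comment> \<open>Values in \<open>ereal\<close> may be infinite here; an infinite end of a strict
    inequality makes the difference \<infinity>, which is still positive.\<close>
  with nondegenerate have pos: "0 < F_max V K F - F_min V K F"
    by (cases rule: ereal2_cases[of "F_max V K F" "F_min V K F"]) auto
  have "rho V K F A \<le> rho V K F B"
    unfolding rho_def using pos antimono[OF B(1)]
    by (intro ereal_divide_right_mono ereal_minus_mono) auto
  with A B show ?thesis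
    by (auto simp: L_sets_def intro: order_trans)
qed

text \<open>This separates the combinatorics from the random walk. By \<open>level\<close>, the
  index of a level is the cardinality of its members, so comparing cardinalities in G3 means
  comparing indices.\<close>

lemma greedoid_if_graded:
  fixes H :: "nat \<Rightarrow> 'a set set"
  assumes "finite V" and H_0: "H 0 = {{}}"
    and level: "\<And>n A. n \<le> K \<Longrightarrow> A \<in> H n \<Longrightarrow> A \<subseteq> V \<and> card A = n"
    and access: "\<And>n A. Suc n \<le> K \<Longrightarrow> A \<in> H (Suc n) \<Longrightarrow> \<exists>B\<in>H n. B \<subseteq> A"
    and exchange: "\<And>n A B. Suc n \<le> K \<Longrightarrow> B \<in> H n \<Longrightarrow> A \<in> H (Suc n) \<Longrightarrow>
      \<exists>x\<in>A - B. B \<union> {x} \<in> H (Suc n)"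
  shows "greedoid V (\<Union>n\<le>K. H n)"
  unfolding greedoid_def
proof (intro conjI ballI impI)
  show "finite V" by fact
  show "(\<Union>n\<le>K. H n) \<subseteq> Pow V"
    using level by auto
  show "{} \<in> (\<Union>n\<le>K. H n)"
    using H_0 by auto
next
  fix A assume "A \<in> (\<Union>n\<le>K. H n)" and "A \<noteq> {}"
  then obtain n where n: "Suc n \<le> K" "A \<in> H (Suc n)"
    using H_0 by (metis UN_E atMost_iff not0_implies_Suc singletonD)
  then obtain B where B: "B \<in> H n" "B \<subseteq> A"
    using access by blast
  have fin: "finite A" and cards: "card A = Suc n" "card B = n"
    using level[of "Suc n" A] level[of n B] n B \<open>finite V\<close> by (auto intro: finite_subset)
  \<comment> \<open>Neighbouring levels differ by one in cardinality, so the inclusion from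
    \<open>access\<close> is the removal of a single point, as G2 demands.\<close>
  have "card (A - B) = 1"
    using card_Diff_subset[of B A] B cards fin by (auto dest: finite_subset)
  then obtain a where "A - B = {a}"
    by (auto simp: card_1_singleton_iff)
  then have "a \<in> A" "A - {a} = B"
    using B by auto
  then show "\<exists>a\<in>A. A - {a} \<in> (\<Union>n\<le>K. H n)"
    using n B by (intro bexI[of _ a]) auto
next
  fix A B assume A: "A \<in> (\<Union>n\<le>K. H n)" and B: "B \<in> (\<Union>n\<le>K. H n)" and "card B < card A"
  define k where "k = card B"
  have k: "B \<in> H k" and "k \<le> K"
    using B level by (auto simp: k_def)
  obtain n where n: "n \<le> K" "A \<in> H n" and "Suc k \<le> n"
    using A \<open>card B < card A\<close> level by (auto simp: k_def Suc_le_eq)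
  \<comment> \<open>Descend from A one level at a time, stopping just above the level of B, where
    \<open>exchange\<close> applies. A point of C - B then also lies in A - B.\<close>
  from \<open>Suc k \<le> n\<close> n have "\<exists>C\<in>H (Suc k). C \<subseteq> A"
  proof (induction n arbitrary: A rule: dec_induct)
    case base
    then show ?case by auto
  next
    case (step n)
    then obtain D where "D \<in> H n" "D \<subseteq> A"
      using access by blast
    then show ?case
      using step.IH[of D] step.prems by auto
  qed
  then obtain C where C: "C \<in> H (Suc k)" "C \<subseteq> A" by blast
  then obtain x where "x \<in> C - B" "B \<union> {x} \<in> H (Suc k)"
    using exchange[of k B C] k n \<open>Suc k \<le> n\<close> by auto
  with C n \<open>Suc k \<le> n\<close> show "\<exists>x\<in>A - B. B \<union> {x} \<in> (\<Union>n\<le>K. H n)"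
    by (intro bexI[of _ x]) (auto intro!: bexI[of _ "Suc k"])
qed

theorem theorem1:
  fixes N K m :: nat and V :: "nat set" and E :: "nat set set"
    and p :: "nat \<Rightarrow> nat \<Rightarrow> real" and c :: real
    and M :: "nat \<Rightarrow> 'w measure" and X :: "nat \<Rightarrow> 'w \<Rightarrow> nat"
    and F :: "nat set \<Rightarrow> ereal" and L :: "nat set set"
    and G g_hat G_hat :: "nat \<Rightarrow> nat set set"
  assumes V: "V = {1..N}"
    and graph: "connected_graph V E"
    and matrix: "transition_matrix V E p" "irreducible_matrix V p" "aperiodic_matrix V p"
    and walk: "\<And>i. i \<in> V \<Longrightarrow> markov_chain_from V p i (M i) X"
    and F: "F = total_hitting_time V M X"
    and K: "0 < K" "K \<le> N"
    and nondegenerate: "F_max V K F \<noteq> F_min V K F"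
    and c: "0 < c" "c \<le> 1"
    and L: "L = L_sets V K F c"
    and m: "m = Min (card ` L)" "m \<le> K"
    and G: "\<And>n. m \<le> n \<Longrightarrow> n \<le> K \<Longrightarrow> G n = {A \<in> L. card A = n}"
    and g_hat_0: "g_hat 0 = {{}}"
    and g_hat: "\<And>n A. 1 \<le> n \<Longrightarrow> n \<le> m \<Longrightarrow> A \<in> g_hat n \<Longrightarrow>
                  A \<subseteq> V \<and> card A = n \<and> (\<exists>B\<in>G m. A \<subseteq> B)"
    and G_hat: "\<And>n A. m \<le> n \<Longrightarrow> n \<le> K \<Longrightarrow> A \<in> G_hat n \<Longrightarrow>
                  A \<subseteq> V \<and> card A = n \<and> (\<exists>B\<in>G m. B \<subseteq> A)"
    and T1: "g_hat m = G_hat m" "G_hat m \<subseteq> G m"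
    and T2: "\<And>n A. 1 \<le> n \<Longrightarrow> n \<le> m \<Longrightarrow> A \<in> g_hat n \<Longrightarrow> \<exists>B\<in>g_hat (n - 1). B \<subseteq> A"
    and T3: "\<And>n A B. 1 \<le> n \<Longrightarrow> n \<le> m \<Longrightarrow> B \<in> g_hat (n - 1) \<Longrightarrow> A \<in> g_hat n \<Longrightarrow>
               \<exists>q\<in>A - B. B \<union> {q} \<in> g_hat n"
    and T4: "\<And>n. m < n \<Longrightarrow> n \<le> K \<Longrightarrow> G_hat n = {A \<in> G n. \<exists>B\<in>G_hat (n - 1). B \<subset> A}"
  shows "greedoid V ({{}} \<union> (\<Union>n\<in>{1..m - 1}. g_hat n) \<union> (\<Union>n\<in>{m..K}. G_hat n))"
proof -
  have "finite V"
    using V by simp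
  have superset: "B \<in> L" if "A \<in> L" "A \<subseteq> B" "B \<subseteq> V" "card B \<le> K" for A B
    unfolding L
    by (rule L_sets_superset[OF \<open>finite V\<close> _ nondegenerate])
      (use that in \<open>auto simp: L F intro: total_hitting_time_antimono[OF \<open>finite V\<close>]\<close>)
  \<comment> \<open>\<open>Min\<close> says nothing about m unless L is known to be nonempty, so the
    argument goes through T1 and the convention for \<open>g_hat 0\<close>: at m = 0 they would put
    the empty set into L.\<close>
  have "m \<noteq> 0"
  proof
    assume "m = 0"
    then have "{} \<in> L"
      using g_hat_0 T1 G[of m] by auto
    then show False
      by (simp add: L L_sets_def)
  qed
  \<comment> \<open>By T1 both descriptions agree at level m. This closes the seam: T3 into level m
    speaks of \<open>g_hat m\<close>, T4 out of it of \<open>G_hat m\<close>.\<close>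
  define H where "H n = (if n < m then g_hat n else G_hat n)" for n
  have H_le: "H n = g_hat n" if "n \<le> m" for n
    using that T1 by (auto simp: H_def)
  have H_ge: "H n = G_hat n" if "m \<le> n" for n
    using that by (auto simp: H_def)
  have H_0: "H 0 = {{}}"
    using g_hat_0 by (simp add: H_le)
  have level: "A \<subseteq> V \<and> card A = n" if "n \<le> K" "A \<in> H n" for n A
  proof (cases "n = 0")
    case True
    then show ?thesis
      using that H_0 by simp
  next
    case False
    then show ?thesis
      using that g_hat[of n A] G_hat[of n A] by (cases "n < m") (auto simp: H_def)
  qed
  have "greedoid V (\<Union>n\<le>K. H n)"
  proof (rule greedoid_if_graded[where H = H and K = K, OF \<open>finite V\<close> H_0 level])
    fix n A assume n: "Suc n \<le> K" "A \<in> H (Suc n)"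
    show "\<exists>B\<in>H n. B \<subseteq> A"
    proof (cases "Suc n \<le> m")
      case True
      then show ?thesis
        using n T2[of "Suc n" A] by (simp add: H_le)
    next
      case False
      then show ?thesis
        using n T4[of "Suc n"] by (auto simp: H_ge)
    qed
  next
    fix n A B assume n: "Suc n \<le> K" "B \<in> H n" "A \<in> H (Suc n)"
    show "\<exists>x\<in>A - B. B \<union> {x} \<in> H (Suc n)"
    proof (cases "Suc n \<le> m")
      case True
      then show ?thesis
        using n T3[of "Suc n" B A] by (simp add: H_le)
    next
      case False
      \<comment> \<open>Now m \<le> n. Every x in A - B will do, and one exists because A is larger
        than B.\<close>
      have A: "A \<subseteq> V" "card A = Suc n" and B: "B \<subseteq> V" "card B = n"
        using level[of n B] level[of "Suc n" A] n by auto
      then have "finite B"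
        using \<open>finite V\<close> by (auto intro: finite_subset)
      then have "\<not> A \<subseteq> B"
        using card_mono[of B A] A B by auto
      then obtain x where x: "x \<in> A - B" by blast
      have card: "card (B \<union> {x}) = Suc n"
        using x B \<open>finite B\<close> by simp
      \<comment> \<open>The member C of L below B carries membership in L up to the extended set,
        whose size is at most K.\<close>
      obtain C where "C \<in> G m" "C \<subseteq> B"
        using G_hat[of n B] n False by (auto simp: H_ge)
      then have "B \<union> {x} \<in> L"
        using superset[of C "B \<union> {x}"] G[of m] m(2) A B x card n by auto
      then have "B \<union> {x} \<in> G (Suc n)"
        using G[of "Suc n"] False n card by auto
      \<comment> \<open>B itself is the proper subset one level down that T4 asks for.\<close>
      moreover have "B \<in> G_hat n" "B \<subset> B \<union> {x}"
        using n x False by (auto simp: H_ge)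
      ultimately have "B \<union> {x} \<in> H (Suc n)"
        using T4[of "Suc n"] False n by (auto simp: H_ge)
      with x show ?thesis by blast
    qed
  qed auto
  \<comment> \<open>Level 0 supplies the separate \<open>{{}}\<close> of the goal; for m = 1 the
    middle range is empty.\<close>
  also have "{..K} = {0} \<union> {1..m - 1} \<union> {m..K}"
    using \<open>m \<noteq> 0\<close> m(2) by auto
  then have "(\<Union>n\<le>K. H n) = H 0 \<union> (\<Union>n\<in>{1..m - 1}. H n) \<union> (\<Union>n\<in>{m..K}. H n)"
    by (simp add: Un_assoc)
  also have "(\<Union>n\<in>{1..m - 1}. H n) = (\<Union>n\<in>{1..m - 1}. g_hat n)"
    by (rule SUP_cong) (auto simp: H_le)
  also have "(\<Union>n\<in>{m..K}. H n) = (\<Union>n\<in>{m..K}. G_hat n)"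
    by (rule SUP_cong) (auto simp: H_ge)
  finally show ?thesis
    unfolding H_0 .
qed

end
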